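(* Let $\mathbb F=\mathbb Z_{\max}$, and let $\mathbb P:\mathcal P_{\mathbb F}\to\mathfrak{Fin}$ be the functor to the category of finite sets given by $\mathbb P(E)=(E\setminus\{0\})/\mathbb F^\times$. (i) The functor $\mathbb P:\mathcal P_{\mathbb F}\to\mathfrak{Fin}$ is full. (ii) Let $\sigma\in\mathrm{Hom}_{\mathfrak{Fin}}([n],[m])$. Then $\mathrm{cdesc}(\sigma)$ is the smallest integer $k$ such that there exists $f\in\mathrm{Hom}_{\mathcal P_{\mathbb F}}(\mathbb F^{(n+1)},\mathbb F^{(m+1)})$ with $\mathrm{Mod}(f)=k$ and $\mathbb P(f)=\sigma$. (iii) Let $\sigma\in\mathrm{Hom}_{\mathfrak{Fin}}([n],[m])$ with $\mathrm{cdesc}(\sigma)=k$. Then there exists a unique $f\in\mathrm{Hom}_{\mathcal P_{\mathbb F}}(\mathbb F^{(n+1)},\mathbb F^{(m+1)})$ with $\mathrm{Mod}(f)=k$ such that $\mathbb P(f)=\sigma$.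
   Context: $\mathbb F=\mathbb Z_{\max}=(\mathbb Z\cup\{-\infty\},\max,+)$ is written multiplicatively: its elements are $0$ and $u^n$, $n\in\mathbb Z$, with addition $u^n\vee u^m=u^{\max(n,m)}$, $0$ neutral for addition, and $u^nu^m=u^{n+m}$. For $n\in\mathbb N^\times$ (the multiplicative monoid of positive integers) let $\mathrm{Fr}_n\in\mathrm{End}(\mathbb F)$ be the endomorphism $\mathrm{Fr}_n(x)=x^n$; the semigroup $\mathrm{End}(\mathbb F)$ of semifield endomorphisms is identified with $\mathbb N^\times$ by $n\mapsto\mathrm{Fr}_n$. For $n\ge1$, $\mathbb F^{(n)}$ is the semimodule over $\mathbb F$ obtained from $\mathbb F$ by restriction of scalars: it has the additive monoid of $\mathbb F$ and action $\lambda.\xi=\mathrm{Fr}_n(\lambda)\xi$; thus its non-zero elements form the ordered set $\mathbb Z$ (via $u^i\leftrightarrow i$), on which $u$ acts by $x\mapsto x+n$. $\mathcal P_{\mathbb F}$ is the category with objects $\mathbb F^{(n)}$, $n\ge1$; a morphism $E_1\to E_2$ is a pair consisting of an endomorphism $\phi\in\mathrm{End}(\mathbb F)$ and a projective class of additive maps $f:E_1\to E_2$ with $f^{-1}(\{0\})=\{0\}$ and $f(\lambda x)=\phi(\lambda)f(x)$ for all $\lambda\in\mathbb F$, $x\in E_1$. Two such maps are in the same projective class if one is the multiple of the other by a non-zero element of $\mathbb F$. Since $\mathrm{End}(\mathbb F)\sim\mathbb N^\times$, assigning to a morphism its endomorphism $\phi=\mathrm{Fr}_k$ gives a functor $\mathrm{Mod}:\mathcal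 P_{\mathbb F}\to\mathbb N^\times$ ($\mathbb N^\times$ viewed as a category with a single object), $\mathrm{Mod}(f)=k$. A morphism $f:E_1\to E_2$ induces a map of sets $\mathbb P(f):\mathbb P(E_1)\to\mathbb P(E_2)$. Write $[n]=\{0,1,\dots,n\}$, $n\ge0$, and identify $\mathbb P(\mathbb F^{(n+1)})$ with $[n]$ using the fundamental domain $\{0,\dots,n\}\subset\mathbb Z$. The cyclic descent number of a map of sets $\sigma:[n]\to[m]$ is $\mathrm{cdesc}(\sigma)=\#\{j\in\{0,1,\dots,n\}\mid\sigma(j+1)<\sigma(j)\}$, where $n+1$ is identified with $0$, i.e. $\sigma(n+1):=\sigma(0)$.
   Formalization: End(F) here also contains Fr_0 (all non-zero elements sent to 1), so Mod may be 0; with only positive integers, (ii) and (iii) fail for constant σ, where cdesc(σ)=0. Fullness (i) is still shown with Mod(f) ≥ 1. *)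

theory Defs
  imports Main "HOL-Library.FuncSet"
begin

text \<open>\<open>U i\<close> is the element written $u^i$, and \<open>Bot\<close> is the zero element (minus infinity).\<close>

datatype zmax = Bot | U int

instantiation zmax :: comm_semiring_1
begin

definition zero_zmax :: zmax where "0 = Bot"

definition one_zmax :: zmax where "1 = U 0"

fun plus_zmax :: "zmax \<Rightarrow> zmax \<Rightarrow> zmax" where
  "Bot + y = y"
| "U i + Bot = U i"
| "U i + U j = U (max i j)"

fun times_zmax :: "zmax \<Rightarrow> zmax \<Rightarrow> zmax" where
  "Bot * y = Bot"
| "U i * Bot = Bot"
| "U i * U j = U (i + j)"

instance
proof
  fix a b c :: zmax
  show "a * b * c = a * (b * c)" by (cases a; cases b; cases c) auto
  show "a * b = b * a" by (cases a; cases b) auto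
  show "1 * a = a" by (cases a) (auto simp: one_zmax_def)
  show "a + b + c = a + (b + c)" by (cases a; cases b; cases c) auto
  show "a + b = b + a" by (cases a; cases b) auto
  show "0 + a = a" by (auto simp: zero_zmax_def)
  show "0 * a = 0" by (auto simp: zero_zmax_def)
  show "a * 0 = 0" by (cases a) (auto simp: zero_zmax_def)
  show "(a + b) * c = a * c + b * c" by (cases a; cases b; cases c) auto
  show "(0::zmax) \<noteq> 1" by (auto simp: zero_zmax_def one_zmax_def)
qed

end

lemma U_neq_0 [simp]: "U i \<noteq> 0" "0 \<noteq> U i"
  by (auto simp: zero_zmax_def)

lemma zmax_neq_0_iff: "x \<noteq> 0 \<longleftrightarrow> (\<exists>i. x = U i)"
  by (cases x) (auto simp: zero_zmax_def)

lemma mult_eq_0_zmax [simp]: "(x::zmax) * y = 0 \<longleftrightarrow> x = 0 \<or> y = 0"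
  by (cases x; cases y) (auto simp: zero_zmax_def)

lemma U_power [simp]: "U i ^ k = U (int k * i)"
  by (induction k) (auto simp: one_zmax_def algebra_simps)

definition semifield_endo :: "(zmax \<Rightarrow> zmax) \<Rightarrow> bool" where
  "semifield_endo \<phi> \<longleftrightarrow>
     \<phi> 0 = 0 \<and> \<phi> 1 = 1 \<and>
     (\<forall>x y. \<phi> (x + y) = \<phi> x + \<phi> y) \<and>
     (\<forall>x y. \<phi> (x * y) = \<phi> x * \<phi> y)"

text \<open>
  The case distinction only matters for \<open>k = 0\<close>, where \<open>0 ^ 0 = 1\<close> in the library.
  \<open>Fr 0\<close> is the endomorphism sending every non-zero element to \<open>1\<close> (and \<open>0\<close> to \<open>0\<close>).
  It satisfies the definition of a semifield endomorphism, so the endomorphisms are the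
  \<open>Fr k\<close> with \<open>k \<ge> 0\<close> (see \<open>semifield_endo_iff\<close>); the injective ones are those with
  \<open>k \<ge> 1\<close>.
\<close>

definition Fr :: "nat \<Rightarrow> zmax \<Rightarrow> zmax" where
  "Fr k x = (if x = 0 then 0 else x ^ k)"

lemma Fr_simps [simp]: "Fr k 0 = 0" "Fr k (U i) = U (int k * i)"
  by (auto simp: Fr_def)

lemma Fr_eq_0_iff [simp]: "Fr k x = 0 \<longleftrightarrow> x = 0"
  by (cases x) (auto simp flip: zero_zmax_def)

lemma Fr_mult: "Fr k (x * y) = Fr k x * Fr k y"
  by (cases x; cases y) (auto simp: algebra_simps simp flip: zero_zmax_def)

lemma Fr_add: "Fr k (x + y) = Fr k x + Fr k y"
proof (cases x; cases y)
  fix i j assume "x = U i" "y = U j"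
  moreover have "int k * max i j = max (int k * i) (int k * j)"
    by (cases "i \<le> j") (simp_all add: max_absorb1 max_absorb2 mult_left_mono)
  ultimately show ?thesis by simp
qed (simp_all flip: zero_zmax_def)

lemma Fr_1_left [simp]: "Fr k 1 = 1"
  by (simp add: one_zmax_def)

lemma Fr_inject [simp]: "Fr k = Fr l \<longleftrightarrow> k = l"
proof
  assume "Fr k = Fr l"
  then have "Fr k (U 1) = Fr l (U 1)" by simp
  then show "k = l" by simp
qed simp

lemma semifield_endo_iff: "semifield_endo \<phi> \<longleftrightarrow> (\<exists>k. \<phi> = Fr k)"
proof
  assume \<phi>: "semifield_endo \<phi>"
  have mult: "\<phi> (x * y) = \<phi> x * \<phi> y" for x y using \<phi> by (simp add: semifield_endo_def)
  have nz: "\<phi> (U i) \<noteq> 0" for i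
  proof
    assume "\<phi> (U i) = 0"
    then have "\<phi> (U i * U (- i)) = 0" by (simp only: mult mult_zero_left)
    then have "\<phi> 1 = 0" by (simp add: one_zmax_def)
    then show False using \<phi> by (simp add: semifield_endo_def)
  qed
  then obtain e where e: "\<phi> (U i) = U (e i)" for i
    unfolding zmax_neq_0_iff by metis
  have add: "e (i + j) = e i + e j" for i j
    using mult[of "U i" "U j"] by (simp add: e)
  have "\<phi> (U 0 + U 1) = \<phi> (U 0) + \<phi> (U 1)" using \<phi> by (simp only: semifield_endo_def)
  then have "e 0 \<le> e 1" by (simp add: e)
  moreover have "e 0 = 0" using add[of 0 0] by simp
  ultimately have "e 1 \<ge> 0" by simp
  have lin: "e i = e 1 * i" for i
  proof (induction i rule: int_induct[where k = 0])
    case base show ?case using \<open>e 0 = 0\<close> by simp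
  next
    case (step1 i) then show ?case by (simp add: add algebra_simps)
  next
    case (step2 i) then show ?case using add[of "i - 1" 1] by (simp add: algebra_simps)
  qed
  have "\<phi> x = Fr (nat (e 1)) x" for x
  proof (cases x)
    case Bot then show ?thesis using \<phi> by (simp add: semifield_endo_def flip: zero_zmax_def)
  next
    case (U i) then show ?thesis using \<open>e 1 \<ge> 0\<close> lin[of i] by (simp add: e)
  qed
  then show "\<exists>k. \<phi> = Fr k" by blast
qed (auto simp: semifield_endo_def Fr_add Fr_mult)

text \<open>
  The semimodule $\mathbb F^{(n)}$ has the additive monoid \<open>zmax\<close>; only the action depends
  on \<open>n\<close>, so an object is given by its index \<open>n \<ge> 1\<close>.
\<close>

definition act :: "nat \<Rightarrow> zmax \<Rightarrow> zmax \<Rightarrow> zmax" where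
  "act n c x = Fr n c * x"

definition semilinear :: "nat \<Rightarrow> nat \<Rightarrow> (zmax \<Rightarrow> zmax) \<Rightarrow> (zmax \<Rightarrow> zmax) set" where
  "semilinear n m \<phi> =
     {f. (\<forall>x y. f (x + y) = f x + f y) \<and> f -` {0} = {0} \<and>
         (\<forall>c x. f (act n c x) = act m (\<phi> c) (f x))}"

definition proj_rel :: "nat \<Rightarrow> nat \<Rightarrow> (zmax \<Rightarrow> zmax) \<Rightarrow> ((zmax \<Rightarrow> zmax) \<times> (zmax \<Rightarrow> zmax)) set" where
  "proj_rel n m \<phi> =
     {(f, g). f \<in> semilinear n m \<phi> \<and> g \<in> semilinear n m \<phi> \<and>
              (\<exists>c. c \<noteq> 0 \<and> g = (\<lambda>x. act m c (f x)))}"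

type_synonym pf_mor = "(zmax \<Rightarrow> zmax) \<times> (zmax \<Rightarrow> zmax) set"

definition Hom_PF :: "nat \<Rightarrow> nat \<Rightarrow> pf_mor set" where
  "Hom_PF n m = {(\<phi>, C). semifield_endo \<phi> \<and> C \<in> semilinear n m \<phi> // proj_rel n m \<phi>}"

text \<open>
  \<open>Mod\<close> takes values in all of \<open>nat\<close>. The subcategory where the endomorphisms are the
  \<open>Fr k\<close> with \<open>k\<close> a positive integer consists of the morphisms with \<open>1 \<le> Mod f\<close>.
\<close>

definition Mod :: "pf_mor \<Rightarrow> nat" where
  "Mod f = (THE k. fst f = Fr k)"

lemma Mod_Fr [simp]: "Mod (Fr k, C) = k"
  by (simp add: Mod_def)

definition orbit_rel :: "nat \<Rightarrow> (zmax \<times> zmax) set" where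
  "orbit_rel n = {(x, y). x \<noteq> 0 \<and> (\<exists>c. c \<noteq> 0 \<and> y = act n c x)}"

definition PP :: "nat \<Rightarrow> zmax set set" where
  "PP n = (UNIV - {0}) // orbit_rel n"

text \<open>
  \<open>\<Union>g\<in>C. g ` X\<close> collects the images of all representatives of the point \<open>X\<close> under all
  representatives of the projective class \<open>C\<close>; they all lie in one orbit
  (see \<open>PP_map_class\<close>).
\<close>

definition PP_map :: "nat \<Rightarrow> nat \<Rightarrow> pf_mor \<Rightarrow> zmax set \<Rightarrow> zmax set" where
  "PP_map n m f = (\<lambda>X \<in> PP n. orbit_rel m `` (\<Union>g\<in>snd f. g ` X))"

definition pt :: "nat \<Rightarrow> nat \<Rightarrow> zmax set" where
  "pt n j = orbit_rel (n + 1) `` {U (int j)}"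

definition represents :: "nat \<Rightarrow> nat \<Rightarrow> pf_mor \<Rightarrow> (nat \<Rightarrow> nat) \<Rightarrow> bool" where
  "represents n m f \<sigma> \<longleftrightarrow>
     (\<forall>j\<in>{0..n}. PP_map (n + 1) (m + 1) f (pt n j) = pt m (\<sigma> j))"

definition cdesc :: "nat \<Rightarrow> (nat \<Rightarrow> nat) \<Rightarrow> nat" where
  "cdesc n \<sigma> = card {j \<in> {0..n}. \<sigma> ((j + 1) mod (n + 1)) < \<sigma> j}"

lemma act_simps [simp]:
  "act n c 0 = 0" "act n 0 x = 0" "act n 1 x = x" "act n (U i) (U j) = U (int n * i + j)"
  by (simp_all add: act_def)

lemma act_act: "act n c (act n d x) = act n (c * d) x"
  by (simp add: act_def Fr_mult mult.assoc)

lemma act_add: "act n c (x + y) = act n c x + act n c y"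
  by (simp add: act_def distrib_left)

lemma act_eq_0_iff [simp]: "act n c x = 0 \<longleftrightarrow> c = 0 \<or> x = 0"
  by (simp add: act_def)

lemma zmax_inverse: "c \<noteq> 0 \<Longrightarrow> \<exists>d::zmax. d \<noteq> 0 \<and> d * c = 1"
proof -
  assume "c \<noteq> 0"
  then obtain i where "c = U i" by (auto simp: zmax_neq_0_iff)
  then have "U (- i) \<noteq> 0 \<and> U (- i) * c = 1" by (simp add: one_zmax_def)
  then show ?thesis by blast
qed

lemma semifield_endo_eq_0: "semifield_endo \<phi> \<Longrightarrow> \<phi> c = 0 \<longleftrightarrow> c = 0"
  by (auto simp: semifield_endo_iff)

lemma semilinear_eq_0: "f \<in> semilinear n m \<phi> \<Longrightarrow> f x = 0 \<longleftrightarrow> x = 0"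
  by (auto simp: semilinear_def)

lemma semilinear_act: "f \<in> semilinear n m \<phi> \<Longrightarrow> f (act n c x) = act m (\<phi> c) (f x)"
  by (auto simp: semilinear_def)

lemma semilinear_scale:
  assumes f: "f \<in> semilinear n m \<phi>" and "c \<noteq> 0"
  shows "(\<lambda>x. act m c (f x)) \<in> semilinear n m \<phi>"
proof -
  have "f x = 0 \<longleftrightarrow> x = 0" for x using f by (rule semilinear_eq_0)
  then show ?thesis
    using f \<open>c \<noteq> 0\<close>
    by (auto simp: semilinear_def act_add act_act mult.commute)
qed

lemma semilinear_comp:
  assumes "f \<in> semilinear n m \<phi>" "g \<in> semilinear m l \<psi>"
  shows "g \<circ> f \<in> semilinear n l (\<psi> \<circ> \<phi>)"
proof -
  have "f x = 0 \<longleftrightarrow> x = 0" "g x = 0 \<longleftrightarrow> x = 0" for x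
    using assms by (auto simp: semilinear_eq_0)
  then show ?thesis using assms by (auto simp: semilinear_def)
qed

lemma equiv_proj_rel: "equiv (semilinear n m \<phi>) (proj_rel n m \<phi>)"
proof (rule equivI)
  show "proj_rel n m \<phi> \<subseteq> semilinear n m \<phi> \<times> semilinear n m \<phi>"
    by (auto simp: proj_rel_def)
  show "refl_on (semilinear n m \<phi>) (proj_rel n m \<phi>)"
    by (auto simp: refl_on_def proj_rel_def intro!: exI[of _ 1])
  show "sym (proj_rel n m \<phi>)"
  proof (rule symI)
    fix f g assume "(f, g) \<in> proj_rel n m \<phi>"
    then obtain c where c: "f \<in> semilinear n m \<phi>" "g \<in> semilinear n m \<phi>" "c \<noteq> 0"
      "g = (\<lambda>x. act m c (f x))" by (auto simp: proj_rel_def)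
    obtain d where "d \<noteq> 0" "d * c = 1" using zmax_inverse[OF c(3)] by blast
    then show "(g, f) \<in> proj_rel n m \<phi>"
      using c by (auto simp: proj_rel_def act_act intro!: exI[of _ d])
  qed
  show "trans (proj_rel n m \<phi>)"
  proof (rule transI)
    fix f g h assume "(f, g) \<in> proj_rel n m \<phi>" "(g, h) \<in> proj_rel n m \<phi>"
    then obtain c d where "f \<in> semilinear n m \<phi>" "h \<in> semilinear n m \<phi>" "c \<noteq> 0" "d \<noteq> 0"
      "h = (\<lambda>x. act m d (act m c (f x)))" by (auto simp: proj_rel_def)
    then show "(f, h) \<in> proj_rel n m \<phi>"
      by (auto simp: proj_rel_def act_act intro!: exI[of _ "d * c"])
  qed
qed

lemma equiv_orbit_rel: "equiv (UNIV - {0}) (orbit_rel n)"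
proof (rule equivI)
  show "orbit_rel n \<subseteq> (UNIV - {0}) \<times> (UNIV - {0})"
    by (auto simp: orbit_rel_def)
  show "refl_on (UNIV - {0}) (orbit_rel n)"
    by (auto simp: refl_on_def orbit_rel_def intro!: exI[of _ 1])
  show "sym (orbit_rel n)"
  proof (rule symI)
    fix x y assume "(x, y) \<in> orbit_rel n"
    then obtain c where c: "x \<noteq> 0" "c \<noteq> 0" "y = act n c x" by (auto simp: orbit_rel_def)
    obtain d where "d \<noteq> 0" "d * c = 1" using zmax_inverse[OF c(2)] by blast
    then show "(y, x) \<in> orbit_rel n"
      using c by (auto simp: orbit_rel_def act_act intro!: exI[of _ d])
  qed
  show "trans (orbit_rel n)"
  proof (rule transI)
    fix x y z assume "(x, y) \<in> orbit_rel n" "(y, z) \<in> orbit_rel n"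
    then obtain c d where "x \<noteq> 0" "c \<noteq> 0" "d \<noteq> 0" "z = act n d (act n c x)"
      by (auto simp: orbit_rel_def)
    then show "(x, z) \<in> orbit_rel n"
      by (auto simp: orbit_rel_def act_act intro!: exI[of _ "d * c"])
  qed
qed

lemma Hom_PF_D:
  assumes "(\<phi>, C) \<in> Hom_PF n m" "g \<in> C"
  shows "semifield_endo \<phi>" "g \<in> semilinear n m \<phi>" "C = proj_rel n m \<phi> `` {g}"
proof -
  from assms have C: "C \<in> semilinear n m \<phi> // proj_rel n m \<phi>" by (simp add: Hom_PF_def)
  then obtain f where f: "f \<in> semilinear n m \<phi>" "C = proj_rel n m \<phi> `` {f}"
    by (auto elim: quotientE)
  with assms(2) have "(f, g) \<in> proj_rel n m \<phi>" by simp
  then show "C = proj_rel n m \<phi> `` {g}" "g \<in> semilinear n m \<phi>"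
    using f equiv_class_eq[OF equiv_proj_rel] by (auto simp: proj_rel_def)
  show "semifield_endo \<phi>" using assms by (simp add: Hom_PF_def)
qed

lemma Hom_PF_nonempty: "(\<phi>, C) \<in> Hom_PF n m \<Longrightarrow> \<exists>g. g \<in> C"
  using in_quotient_imp_non_empty[OF equiv_proj_rel] by (fastforce simp: Hom_PF_def)

lemma PP_map_class:
  assumes f: "(\<phi>, C) \<in> Hom_PF n m" and g: "g \<in> C" and x: "x \<noteq> 0"
  shows "PP_map n m (\<phi>, C) (orbit_rel n `` {x}) = orbit_rel m `` {g x}"
proof -
  note D = Hom_PF_D[OF f g]
  have gx: "g x \<noteq> 0" using x semilinear_eq_0[OF D(2)] by simp
  have "(g x, h y) \<in> orbit_rel m" if "h \<in> C" "(x, y) \<in> orbit_rel n" for h y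
  proof -
    from that(1) D(3) obtain d where d: "d \<noteq> 0" "h = (\<lambda>x. act m d (g x))"
      by (auto simp: proj_rel_def)
    from that(2) obtain c where c: "c \<noteq> 0" "y = act n c x"
      by (auto simp: orbit_rel_def)
    have "h y = act m (d * \<phi> c) (g x)"
      by (simp add: c d semilinear_act[OF D(2)] act_act)
    moreover have "d * \<phi> c \<noteq> 0" using c(1) d(1) semifield_endo_eq_0[OF D(1)] by simp
    ultimately show ?thesis using gx unfolding orbit_rel_def by blast
  qed
  then have "orbit_rel m `` {h y} = orbit_rel m `` {g x}"
    if "h \<in> C" "(x, y) \<in> orbit_rel n" for h y
    using that equiv_class_eq[OF equiv_orbit_rel] by metis
  moreover have "(x, x) \<in> orbit_rel n"
    using x by (auto simp: orbit_rel_def intro!: exI[of _ 1])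
  ultimately have "orbit_rel m `` (\<Union>h\<in>C. h ` (orbit_rel n `` {x})) = orbit_rel m `` {g x}"
    using g by blast
  moreover have "orbit_rel n `` {x} \<in> PP n"
    using x by (auto simp: PP_def intro: quotientI)
  ultimately show ?thesis by (simp add: PP_map_def)
qed

lemma PP_map_in: "f \<in> Hom_PF n m \<Longrightarrow> PP_map n m f \<in> PP n \<rightarrow>\<^sub>E PP m"
proof (rule PiE_I)
  fix X assume f: "f \<in> Hom_PF n m" and "X \<in> PP n"
  then obtain x where x: "x \<noteq> 0" "X = orbit_rel n `` {x}"
    by (auto simp: PP_def elim: quotientE)
  obtain \<phi> C where fe: "f = (\<phi>, C)" by (cases f)
  obtain g where g: "g \<in> C" using f Hom_PF_nonempty fe by blast
  have "g x \<noteq> 0" using x Hom_PF_D(2)[OF f[unfolded fe] g] semilinear_eq_0 by blast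
  then show "PP_map n m f X \<in> PP m"
    using PP_map_class[OF f[unfolded fe] g x(1)] x fe by (auto simp: PP_def intro: quotientI)
qed (auto simp: PP_map_def)

definition id_PF :: "nat \<Rightarrow> pf_mor" where
  "id_PF n = (id, proj_rel n n id `` {id})"

definition comp_PF :: "pf_mor \<Rightarrow> pf_mor \<Rightarrow> pf_mor" where
  "comp_PF g f = (fst g \<circ> fst f, {v \<circ> u |u v. u \<in> snd f \<and> v \<in> snd g})"

lemma id_PF_in_Hom: "id_PF n \<in> Hom_PF n n"
  by (auto simp: id_PF_def Hom_PF_def semifield_endo_def semilinear_def intro!: quotientI)

lemma comp_PF_in_Hom:
  assumes f: "f \<in> Hom_PF n m" and g: "g \<in> Hom_PF m l"
  shows "comp_PF g f \<in> Hom_PF n l"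
proof -
  obtain \<phi> C \<psi> D where e: "f = (\<phi>, C)" "g = (\<psi>, D)" by (cases f, cases g)
  obtain u v where uv: "u \<in> C" "v \<in> D" using f g e Hom_PF_nonempty by blast
  note F = Hom_PF_D[OF f[unfolded e] uv(1)] and G = Hom_PF_D[OF g[unfolded e] uv(2)]
  have vu: "v \<circ> u \<in> semilinear n l (\<psi> \<circ> \<phi>)" using F(2) G(2) by (rule semilinear_comp)
  have "{b \<circ> a |a b. a \<in> C \<and> b \<in> D} = proj_rel n l (\<psi> \<circ> \<phi>) `` {v \<circ> u}" (is "?L = ?R")
  proof
    show "?L \<subseteq> ?R"
    proof
      fix h assume "h \<in> ?L"
      then obtain a b where ab: "a \<in> C" "b \<in> D" "h = b \<circ> a" by blast
      obtain c where c: "c \<noteq> 0" "a = (\<lambda>x. act m c (u x))"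
        using ab(1) F(3) by (auto simp: proj_rel_def)
      obtain d where d: "d \<noteq> 0" "b = (\<lambda>x. act l d (v x))"
        using ab(2) G(3) by (auto simp: proj_rel_def)
      have h: "h = (\<lambda>x. act l (d * \<psi> c) ((v \<circ> u) x))"
        by (auto simp: ab c d semilinear_act[OF G(2)] act_act)
      moreover have nz: "d * \<psi> c \<noteq> 0" using c d semifield_endo_eq_0[OF G(1)] by simp
      ultimately have "h \<in> semilinear n l (\<psi> \<circ> \<phi>)" using semilinear_scale[OF vu] by metis
      then show "h \<in> ?R" using vu h nz unfolding proj_rel_def by blast
    qed
    show "?R \<subseteq> ?L"
    proof
      fix h assume "h \<in> ?R"
      then obtain d where d: "d \<noteq> 0" "h = (\<lambda>x. act l d ((v \<circ> u) x))"
        by (auto simp: proj_rel_def)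
      have "(\<lambda>x. act l d (v x)) \<in> D"
        using G(2) d(1) semilinear_scale[OF G(2)] by (subst G(3)) (auto simp: proj_rel_def)
      moreover have "h = (\<lambda>x. act l d (v x)) \<circ> u" using d by auto
      ultimately show "h \<in> ?L" using uv by blast
    qed
  qed
  moreover have "semifield_endo (\<psi> \<circ> \<phi>)" using F(1) G(1) by (auto simp: semifield_endo_def)
  ultimately show ?thesis
    using vu by (auto simp: comp_PF_def Hom_PF_def e intro!: quotientI)
qed

lemma PP_map_id: "PP_map n n (id_PF n) = (\<lambda>X \<in> PP n. X)"
proof (rule extensionalityI[of _ "PP n"])
  fix X assume "X \<in> PP n"
  then obtain x where x: "x \<noteq> 0" "X = orbit_rel n `` {x}"
    by (auto simp: PP_def elim: quotientE)
  have "id \<in> semilinear n n id" by (auto simp: semilinear_def)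
  then have "id \<in> proj_rel n n id `` {id}"
    using equiv_class_self[OF equiv_proj_rel] by blast
  from PP_map_class[OF _ this x(1)] show "PP_map n n (id_PF n) X = (\<lambda>X \<in> PP n. X) X"
    using id_PF_in_Hom[of n] x \<open>X \<in> PP n\<close> by (simp add: id_PF_def)
qed (auto simp: PP_map_def)

lemma PP_map_comp:
  assumes f: "f \<in> Hom_PF n m" and g: "g \<in> Hom_PF m l"
  shows "PP_map n l (comp_PF g f) = compose (PP n) (PP_map m l g) (PP_map n m f)"
proof (rule extensionalityI[of _ "PP n"])
  fix X assume X: "X \<in> PP n"
  then obtain x where x: "x \<noteq> 0" "X = orbit_rel n `` {x}"
    by (auto simp: PP_def elim: quotientE)
  obtain \<phi> C \<psi> D where e: "f = (\<phi>, C)" "g = (\<psi>, D)" by (cases f, cases g)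
  obtain u v where uv: "u \<in> C" "v \<in> D" using f g e Hom_PF_nonempty by blast
  have ux: "u x \<noteq> 0" using x Hom_PF_D(2)[OF f[unfolded e] uv(1)] semilinear_eq_0 by blast
  have "comp_PF g f = (\<psi> \<circ> \<phi>, snd (comp_PF g f))" "v \<circ> u \<in> snd (comp_PF g f)"
    using uv by (auto simp: comp_PF_def e)
  then have "PP_map n l (comp_PF g f) X = orbit_rel l `` {v (u x)}"
    using PP_map_class[of "\<psi> \<circ> \<phi>" "snd (comp_PF g f)" n l "v \<circ> u" x]
      comp_PF_in_Hom[OF f g] x by simp
  then show "PP_map n l (comp_PF g f) X = compose (PP n) (PP_map m l g) (PP_map n m f) X"
    using X x PP_map_class[OF f[unfolded e] uv(1) x(1)] PP_map_class[OF g[unfolded e] uv(2) ux]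
    by (simp add: compose_def e)
qed (auto simp: PP_map_def compose_def)

lemma bij_betw_pt: "bij_betw (pt n) {0..n} (PP (n + 1))"
  unfolding bij_betw_def
proof
  have cls: "pt n i = pt n j \<longleftrightarrow> int i mod int (n + 1) = int j mod int (n + 1)" for i j
  proof -
    have "pt n i = pt n j \<longleftrightarrow> (U (int i), U (int j)) \<in> orbit_rel (n + 1)"
      unfolding pt_def by (rule eq_equiv_class_iff[OF equiv_orbit_rel]) auto
    also have "\<dots> \<longleftrightarrow> (\<exists>c. int j = int (n + 1) * c + int i)"
      by (auto simp: orbit_rel_def zmax_neq_0_iff)
    also have "\<dots> \<longleftrightarrow> int (n + 1) dvd int j - int i"
      by (auto simp: dvd_def algebra_simps)
    finally show ?thesis by (auto simp: mod_eq_dvd_iff dvd_diff_commute)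
  qed
  show "inj_on (pt n) {0..n}"
    by (rule inj_onI) (auto simp: cls)
  show "pt n ` {0..n} = PP (n + 1)"
  proof
    show "pt n ` {0..n} \<subseteq> PP (n + 1)"
      by (auto simp: pt_def PP_def intro!: quotientI)
    show "PP (n + 1) \<subseteq> pt n ` {0..n}"
    proof
      fix X assume "X \<in> PP (n + 1)"
      then obtain i where X: "X = orbit_rel (n + 1) `` {U i}"
        unfolding PP_def by (elim quotientE) (auto simp: zmax_neq_0_iff)
      define j where "j = nat (i mod int (n + 1))"
      have j: "int j = i mod int (n + 1)" by (simp add: j_def)
      have "U i = act (n + 1) (U (i div int (n + 1))) (U (int j))"
        unfolding act_simps j by simp
      then have "(U (int j), U i) \<in> orbit_rel (n + 1)"
        by (auto simp only: orbit_rel_def U_neq_0 mem_Collect_eq split_conv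
            intro!: exI[of _ "U (i div int (n + 1))"])
      then have "X = pt n j"
        using equiv_class_eq[OF equiv_orbit_rel] X by (simp add: pt_def)
      moreover have "int j < int (n + 1)" unfolding j by (rule pos_mod_bound) simp
      then have "j \<in> {0..n}" by simp
      ultimately show "X \<in> pt n ` {0..n}" by blast
    qed
  qed
qed

lemma Mod_0_imp_constant:
  assumes f: "f \<in> Hom_PF n m" "Mod f = 0" and "0 < n"
  shows "\<exists>y. y \<noteq> 0 \<and> (\<forall>g\<in>snd f. \<exists>c. c \<noteq> 0 \<and> (\<forall>x. x \<noteq> 0 \<longrightarrow> g x = act m c y))"
proof -
  obtain \<phi> C where e: "f = (\<phi>, C)" by (cases f)
  obtain g where g: "g \<in> C" using f e Hom_PF_nonempty by blast
  note D = Hom_PF_D[OF f(1)[unfolded e] g]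
  obtain k where "\<phi> = Fr k" using D(1) semifield_endo_iff by blast
  with f(2) e have \<phi>: "\<phi> = Fr 0" by simp
  have add: "g (x + y) = g x + g y" for x y using D(2) by (simp add: semilinear_def)
  have "\<exists>j. g (U i) = U j" for i
    using semilinear_eq_0[OF D(2), of "U i"] by (simp flip: zmax_neq_0_iff)
  then obtain b where b: "g (U i) = U (b i)" for i by metis
  have mono: "b i \<le> b j" if "i \<le> j" for i j
    using add[of "U i" "U j"] that by (simp add: b max_absorb2)
  have per: "b (int n * c + i) = b i" for c i
    using semilinear_act[OF D(2), of "U c" "U i"] by (simp add: b \<phi>)
  have "b i = b 0" for i
  proof (rule antisym)
    have "i \<le> int n * \<bar>i\<bar>" "int n * (- \<bar>i\<bar>) \<le> i"
      using \<open>0 < n\<close> mult_right_mono[of 1 "int n" "\<bar>i\<bar>"] by (auto simp: abs_le_iff)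
    from mono[OF this(1)] mono[OF this(2)] show "b i \<le> b 0" "b 0 \<le> b i"
      using per[of "\<bar>i\<bar>" 0] per[of "- \<bar>i\<bar>" 0] by simp_all
  qed
  then have const: "g x = U (b 0)" if "x \<noteq> 0" for x
    using that b by (auto simp: zmax_neq_0_iff)
  have "\<exists>c. c \<noteq> 0 \<and> (\<forall>x. x \<noteq> 0 \<longrightarrow> h x = act m c (U (b 0)))" if "h \<in> C" for h
  proof -
    from that D(3) obtain c where "c \<noteq> 0" "h = (\<lambda>x. act m c (g x))"
      by (auto simp: proj_rel_def)
    then show ?thesis using const by (intro exI[of _ c]) auto
  qed
  then show ?thesis using e by (intro exI[of _ "U (b 0)"]) auto
qed

text \<open>
  A map \<open>\<sigma>\<close> with \<open>\<sigma> i \<noteq> \<sigma> j\<close> can thus only be represented by morphisms with \<open>Mod f \<ge> 1\<close>: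
  the endomorphism \<open>Fr 0\<close> is relevant for constant maps only, whose cyclic descent
  number is \<open>0\<close>.
\<close>

lemma represents_Mod_0_imp_constant:
  assumes f: "f \<in> Hom_PF (n + 1) (m + 1)" "Mod f = 0" and r: "represents n m f \<sigma>"
    and \<sigma>: "\<sigma> \<in> {0..n} \<rightarrow> {0..m}" and ij: "i \<in> {0..n}" "j \<in> {0..n}"
  shows "\<sigma> i = \<sigma> j"
proof -
  obtain \<phi> C where e: "f = (\<phi>, C)" by (cases f)
  obtain g where g: "g \<in> C" using f e Hom_PF_nonempty by blast
  obtain z where z: "\<And>x. x \<noteq> 0 \<Longrightarrow> g x = z"
    using Mod_0_imp_constant[OF f] g e by fastforce
  have "pt m (\<sigma> k) = orbit_rel (m + 1) `` {z}" if "k \<in> {0..n}" for k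
    using r that PP_map_class[OF f(1)[unfolded e] g, of "U (int k)"] z[of "U (int k)"]
    by (simp add: represents_def pt_def e)
  then have "pt m (\<sigma> i) = pt m (\<sigma> j)" using ij by simp
  moreover have "\<sigma> i \<in> {0..m}" "\<sigma> j \<in> {0..m}" using \<sigma> ij by auto
  moreover have "inj_on (pt m) {0..m}" using bij_betw_pt by (rule bij_betw_imp_inj_on)
  ultimately show ?thesis by (simp add: inj_on_eq_iff)
qed

end

theory Submission
  imports Defs
begin

text \<open>
  A morphism of modulus \<open>k\<close> is given by a nondecreasing \<open>b :: int \<Rightarrow> int\<close> with
  $b(i + (n+1)) = b(i) + k(m+1)$, up to adding multiples of $m+1$; it induces \<open>\<sigma>\<close> iff
  $b(j) \equiv \sigma(j)$ modulo $m+1$. Write $b(j) = \sigma(j) + (m+1) t(j)$. Monotonicity says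
  that \<open>t\<close> never decreases and increases by at least \<open>1\<close> at each cyclic descent of \<open>\<sigma>\<close>.
  Over one period \<open>t\<close> increases by \<open>k\<close>, so \<open>k\<close> is at least the number of descents; in case
  of equality all increments of \<open>t\<close> are determined. If \<open>k\<close> is larger, the excess can be put
  into the last step of the period.
\<close>

section \<open>Semilinear maps as monotone equivariant maps of the integers\<close>

definition zlift :: "(int \<Rightarrow> int) \<Rightarrow> zmax \<Rightarrow> zmax" where
  "zlift b x = (case x of Bot \<Rightarrow> 0 | U i \<Rightarrow> U (b i))"

lemma zlift_simps [simp]: "zlift b 0 = 0" "zlift b (U i) = U (b i)"
  by (simp_all add: zlift_def zero_zmax_def)

lemma zlift_eq_0_iff [simp]: "zlift b x = 0 \<longleftrightarrow> x = 0"
  by (cases x) (simp_all flip: zero_zmax_def)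

text \<open>Semilinearity over \<open>Fr k\<close> read on exponents. Addition is a maximum, so
  additivity becomes monotonicity. The scalar \<open>U c\<close> translates the source by
  \<open>n * c\<close>, while its image \<open>Fr k (U c)\<close> translates the target by
  \<open>m * (k * c)\<close>.\<close>

definition equivariant :: "nat \<Rightarrow> nat \<Rightarrow> nat \<Rightarrow> (int \<Rightarrow> int) \<Rightarrow> bool" where
  "equivariant n m k b \<longleftrightarrow> mono b \<and> (\<forall>c i. b (int n * c + i) = int m * (int k * c) + b i)"

lemma zlift_in_semilinear:
  assumes "equivariant n m k b"
  shows "zlift b \<in> semilinear n m (Fr k)"
proof -
  have mono: "mono b" and eqv: "b (int n * c + i) = int m * (int k * c) + b i" for c i
    using assms by (auto simp: equivariant_def)
  have "zlift b (x + y) = zlift b x + zlift b y" for x y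
  proof (cases x; cases y)
    fix i j assume "x = U i" "y = U j"
    then show ?thesis using mono by (simp add: max_of_mono)
  qed (simp_all flip: zero_zmax_def)
  moreover have "zlift b (act n c x) = act m (Fr k c) (zlift b x)" for c x
    by (cases c; cases x) (simp_all add: eqv flip: zero_zmax_def)
  ultimately show ?thesis by (auto simp: semilinear_def)
qed

text \<open>Since only zero is mapped to zero, \<open>f\<close> restricts to a map of exponents.
  Additivity applied to \<open>U i + U j = U j\<close> for i \<le> j makes that map monotone, so
  every semilinear map arises as a lift.\<close>

lemma semilinear_Fr_imp_zlift:
  assumes f: "f \<in> semilinear n m (Fr k)"
  obtains b where "f = zlift b" "equivariant n m k b"
proof -
  have "\<exists>j. f (U i) = U j" for i
    using semilinear_eq_0[OF f, of "U i"] by (simp flip: zmax_neq_0_iff)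
  then obtain b where b: "f (U i) = U (b i)" for i by metis
  have "f x = zlift b x" for x
    using semilinear_eq_0[OF f, of 0] by (cases x) (simp_all add: b flip: zero_zmax_def)
  then have "f = zlift b" by auto
  moreover have "mono b"
  proof
    fix i j :: int assume "i \<le> j"
    have "f (U i + U j) = f (U i) + f (U j)" using f unfolding semilinear_def by blast
    with \<open>i \<le> j\<close> show "b i \<le> b j" by (simp add: b max_absorb2)
  qed
  moreover have "b (int n * c + i) = int m * (int k * c) + b i" for c i
    using semilinear_act[OF f, of "U c" "U i"] by (simp add: b)
  ultimately show thesis using that by (auto simp: equivariant_def)
qed

text \<open>The non-zero scalars act by translation by the multiples of \<open>n\<close>, so the
  orbits of powers of u are residue classes modulo \<open>n\<close>.\<close>

lemma orbit_class_eq_iff: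
  "orbit_rel n `` {U i} = orbit_rel n `` {U j} \<longleftrightarrow> i mod int n = j mod int n"
proof -
  have "orbit_rel n `` {U i} = orbit_rel n `` {U j} \<longleftrightarrow> (U i, U j) \<in> orbit_rel n"
    by (rule eq_equiv_class_iff[OF equiv_orbit_rel]) auto
  also have "\<dots> \<longleftrightarrow> (\<exists>c. j = int n * c + i)"
    by (auto simp: orbit_rel_def zmax_neq_0_iff)
  also have "\<dots> \<longleftrightarrow> int n dvd j - i"
    by (auto simp: dvd_def algebra_simps)
  finally show ?thesis by (auto simp: mod_eq_dvd_iff dvd_diff_commute)
qed

definition mor_of :: "nat \<Rightarrow> nat \<Rightarrow> nat \<Rightarrow> (int \<Rightarrow> int) \<Rightarrow> pf_mor" where
  "mor_of n m k b = (Fr k, proj_rel n m (Fr k) `` {zlift b})"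

lemma Mod_mor_of [simp]: "Mod (mor_of n m k b) = k"
  by (simp add: mor_of_def)

lemma mor_of_in_Hom_PF:
  assumes "equivariant n m k b"
  shows "mor_of n m k b \<in> Hom_PF n m"
  using zlift_in_semilinear[OF assms]
  by (auto simp: mor_of_def Hom_PF_def semifield_endo_iff intro: quotientI)

lemma Hom_PF_imp_mor_of:
  assumes f: "f \<in> Hom_PF n m"
  obtains b where "equivariant n m (Mod f) b" "f = mor_of n m (Mod f) b"
proof -
  obtain \<phi> C where e: "f = (\<phi>, C)" by (cases f)
  obtain g where g: "g \<in> C" using f e Hom_PF_nonempty by blast
  note D = Hom_PF_D[OF f[unfolded e] g]
  obtain k where \<phi>: "\<phi> = Fr k" using D(1) semifield_endo_iff by blast
  obtain b where "g = zlift b" "equivariant n m k b"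
    using semilinear_Fr_imp_zlift D(2) \<phi> by blast
  then show thesis using that D(3) by (simp add: e \<phi> mor_of_def)
qed

text \<open>Translating a lift by \<open>m * c\<close> is the same as scaling it by
  \<open>U c\<close> in the target, which does not leave the projective class. This is the ambiguity
  that remains in the uniqueness statement.\<close>

lemma mor_of_translate:
  assumes b: "equivariant n m k b" and b': "equivariant n m k b'"
    and c: "\<And>i. b' i = b i + int m * c"
  shows "mor_of n m k b' = mor_of n m k b"
proof -
  have "zlift b' x = act m (U c) (zlift b x)" for x
    by (cases x) (simp_all add: c flip: zero_zmax_def)
  then have "zlift b' = (\<lambda>x. act m (U c) (zlift b x))" by blast
  then have "(zlift b, zlift b') \<in> proj_rel n m (Fr k)"
    using zlift_in_semilinear[OF b] zlift_in_semilinear[OF b'] U_neq_0(1)[of c]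
    unfolding proj_rel_def by blast
  then show ?thesis
    using equiv_class_eq[OF equiv_proj_rel] by (fastforce simp: mor_of_def)
qed

text \<open>Points of the projective space are residue classes, and a value of \<sigma> in {0..m} is
  its own residue modulo \<open>m + 1\<close>.\<close>

lemma represents_mor_of_iff:
  assumes b: "equivariant (n + 1) (m + 1) k b" and \<sigma>: "\<sigma> \<in> {0..n} \<rightarrow> {0..m}"
  shows "represents n m (mor_of (n + 1) (m + 1) k b) \<sigma> \<longleftrightarrow>
    (\<forall>j\<in>{0..n}. b (int j) mod int (m + 1) = int (\<sigma> j))"
proof -
  have "zlift b \<in> proj_rel (n + 1) (m + 1) (Fr k) `` {zlift b}"
    using zlift_in_semilinear[OF b] by (rule equiv_class_self[OF equiv_proj_rel])
  then have "PP_map (n + 1) (m + 1) (mor_of (n + 1) (m + 1) k b) (pt n j) =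
      orbit_rel (m + 1) `` {U (b (int j))}" for j
    using PP_map_class[OF mor_of_in_Hom_PF[OF b, unfolded mor_of_def], of "zlift b" "U (int j)"]
    by (simp add: mor_of_def pt_def)
  moreover have "int (\<sigma> j) mod int (m + 1) = int (\<sigma> j)" if "j \<in> {0..n}" for j
    using funcset_mem[OF \<sigma> that] by simp
  ultimately show ?thesis
    unfolding represents_def pt_def[of m]
    by (simp only: orbit_class_eq_iff cong: ball_cong)
qed

section \<open>Cyclic descents and the canonical lift\<close>

definition desc :: "nat \<Rightarrow> (nat \<Rightarrow> nat) \<Rightarrow> nat \<Rightarrow> int" where
  "desc n \<sigma> j = of_bool (\<sigma> ((j + 1) mod (n + 1)) < \<sigma> j)"

lemma cdesc_eq_sum_desc: "int (cdesc n \<sigma>) = (\<Sum>j<n + 1. desc n \<sigma> j)"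
proof -
  have "{0..n} = {..<n + 1}" by auto
  then show ?thesis
    by (simp add: cdesc_def desc_def of_bool_def sum.If_cases Int_def del: sum.lessThan_Suc)
qed

text \<open>The lift normalised by t(0) = 0, with t growing within a period by exactly one at each
  descent and by \<open>k\<close> from one period to the next. Any excess of \<open>k\<close> over
  the descent number thus falls on the step from position \<open>n\<close> to the next
  period.\<close>

definition canonical_lift :: "nat \<Rightarrow> nat \<Rightarrow> nat \<Rightarrow> (nat \<Rightarrow> nat) \<Rightarrow> int \<Rightarrow> int" where
  "canonical_lift n m k \<sigma> i =
     (let r = nat (i mod int (n + 1)) in
      int (\<sigma> r) + int (m + 1) * (int k * (i div int (n + 1)) + (\<Sum>j<r. desc n \<sigma> j)))"

lemma canonical_lift_decomp:
  assumes "r \<le> n"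
  shows "canonical_lift n m k \<sigma> (int (n + 1) * q + int r) =
    int (\<sigma> r) + int (m + 1) * (int k * q + (\<Sum>j<r. desc n \<sigma> j))"
proof -
  have "(int (n + 1) * q + int r) div int (n + 1) = q"
    "(int (n + 1) * q + int r) mod int (n + 1) = int r"
    using assms by (simp_all del: of_nat_Suc of_nat_add)
  then show ?thesis by (simp only: canonical_lift_def Let_def nat_int)
qed

lemma int_decomp:
  fixes i :: int
  obtains q r where "i = int (n + 1) * q + int r" "r \<le> n"
proof
  show "i = int (n + 1) * (i div int (n + 1)) + int (nat (i mod int (n + 1)))"
    by simp
  have "i mod int (n + 1) < int (n + 1)" by (rule pos_mod_bound) simp
  then show "nat (i mod int (n + 1)) \<le> n" by linarith
qed

lemma canonical_lift_step:
  assumes \<sigma>: "\<sigma> \<in> {0..n} \<rightarrow> {0..m}" and k: "cdesc n \<sigma> \<le> k"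
  shows "canonical_lift n m k \<sigma> i \<le> canonical_lift n m k \<sigma> (i + 1)"
proof -
  obtain q r where i: "i = int (n + 1) * q + int r" and r: "r \<le> n" by (rule int_decomp)
  define s where "s = (\<Sum>j<r. desc n \<sigma> j)"
  \<comment> \<open>A descent lowers \<sigma> by at most \<open>m\<close>, so a single multiple of
    \<open>m + 1\<close> makes up for it.\<close>
  have jump: "int (\<sigma> r) \<le> int (\<sigma> ((r + 1) mod (n + 1))) + int (m + 1) * desc n \<sigma> r"
  proof -
    have "\<sigma> r \<le> m" using \<sigma> r by auto
    then show ?thesis by (auto simp: desc_def)
  qed
  have scale: "int (m + 1) * x \<le> int (m + 1) * y" if "x \<le> y" for x y
    using that by (intro mult_left_mono) auto
  show ?thesis
  proof (cases "r = n")
    case False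
    then have "i + 1 = int (n + 1) * q + int (r + 1)" "r + 1 \<le> n" using i r by auto
    then show ?thesis
      using jump canonical_lift_decomp[of r n m k \<sigma> q] canonical_lift_decomp[of "r + 1" n m k \<sigma> q] r
      by (simp only: i) (simp add: algebra_simps)
  next
    case True
    then have i1: "i + 1 = int (n + 1) * (q + 1) + int 0" using i by (simp add: algebra_simps)
    \<comment> \<open>At the end of the period the partial sum together with the last term is the
      whole descent number; only this step needs \<open>k\<close> to be large enough.\<close>
    have "s + desc n \<sigma> r \<le> int k"
      using k True cdesc_eq_sum_desc[of n \<sigma>] by (simp add: s_def)
    then have "int (m + 1) * (int k * q + s + desc n \<sigma> r) \<le> int (m + 1) * (int k * (q + 1) + 0)"
      by (intro scale) (simp add: algebra_simps)
    moreover have "(r + 1) mod (n + 1) = 0" using True by simp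
    moreover have "canonical_lift n m k \<sigma> i = int (\<sigma> r) + int (m + 1) * (int k * q + s)"
      unfolding i s_def by (rule canonical_lift_decomp[OF r])
    moreover have "canonical_lift n m k \<sigma> (i + 1) = int (\<sigma> 0) + int (m + 1) * (int k * (q + 1) + 0)"
      unfolding i1 by (subst canonical_lift_decomp) simp_all
    ultimately show ?thesis
      using jump by (simp only: distrib_left)
  qed
qed

lemma equivariant_canonical_lift:
  assumes "\<sigma> \<in> {0..n} \<rightarrow> {0..m}" "cdesc n \<sigma> \<le> k"
  shows "equivariant (n + 1) (m + 1) k (canonical_lift n m k \<sigma>)"
  unfolding equivariant_def
proof (intro conjI allI)
  show "mono (canonical_lift n m k \<sigma>)"
  proof
    fix i j :: int assume "i \<le> j"
    then show "canonical_lift n m k \<sigma> i \<le> canonical_lift n m k \<sigma> j"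
      by (induction rule: int_ge_induct) (use canonical_lift_step[OF assms] in \<open>auto intro: order_trans\<close>)
  qed
  fix c i
  obtain q r where i: "i = int (n + 1) * q + int r" and r: "r \<le> n" by (rule int_decomp)
  then have ci: "int (n + 1) * c + i = int (n + 1) * (c + q) + int r" by (simp add: algebra_simps)
  show "canonical_lift n m k \<sigma> (int (n + 1) * c + i) =
      int (m + 1) * (int k * c) + canonical_lift n m k \<sigma> i"
    unfolding ci unfolding i canonical_lift_decomp[OF r] by (simp add: algebra_simps)
qed

lemma canonical_lift_mod:
  assumes "\<sigma> \<in> {0..n} \<rightarrow> {0..m}" "j \<in> {0..n}"
  shows "canonical_lift n m k \<sigma> (int j) mod int (m + 1) = int (\<sigma> j)"
proof -
  have "int (\<sigma> j) < int (m + 1)" using funcset_mem[OF assms] by simp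
  then show ?thesis
    using canonical_lift_decomp[of j n m k \<sigma> 0] assms(2)
    by (simp del: of_nat_Suc of_nat_add)
qed

section \<open>Quotients of an arbitrary lift: lower bound and rigidity\<close>

lemma lift_increments:
  fixes b :: "int \<Rightarrow> int" and n m :: nat
  defines "t \<equiv> \<lambda>j::nat. b (int j) div int (m + 1)"
  assumes b: "equivariant (n + 1) (m + 1) k b"
    and res: "\<And>j. j \<in> {0..n} \<Longrightarrow> b (int j) mod int (m + 1) = int (\<sigma> j)"
  shows "\<And>j. j \<le> n \<Longrightarrow> desc n \<sigma> j \<le> t (Suc j) - t j"
    and "(\<Sum>j<n + 1. t (Suc j) - t j) = int k"
proof -
  have eqv: "b (int (n + 1) * c + i) = int (m + 1) * (int k * c) + b i" for c i
    using b by (simp only: equivariant_def)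
  have wrap: "b (int (n + 1)) = int (m + 1) * int k + b 0"
    using eqv[of 1 0] by simp
  show "desc n \<sigma> j \<le> t (Suc j) - t j" if j: "j \<le> n" for j
  proof -
    have le: "b (int j) \<le> b (int (Suc j))"
      using b unfolding equivariant_def by (auto intro: monoD)
    have mod_j: "b (int j) mod int (m + 1) = int (\<sigma> j)" using res j by simp
    \<comment> \<open>For \<open>j = n\<close> equivariance gives that
      \<open>b (int (n + 1))\<close> is congruent to \<open>b 0\<close>, which matches the
      convention that position \<open>n + 1\<close> is identified with 0.\<close>
    have "b (int (Suc j)) mod int (m + 1) = int (\<sigma> ((j + 1) mod (n + 1)))"
    proof (cases "j = n")
      case True
      then have "b (int (Suc j)) mod int (m + 1) = b 0 mod int (m + 1)"
        using wrap by (simp del: of_nat_add)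
      then show ?thesis using res[of 0] True by simp
    next
      case False
      then show ?thesis using res[of "Suc j"] j by simp
    qed
    then have "\<sigma> ((j + 1) mod (n + 1)) < \<sigma> j \<Longrightarrow>
        b (int (Suc j)) mod int (m + 1) < b (int j) mod int (m + 1)"
      using mod_j by simp
    moreover have "t j \<le> t (Suc j)"
      unfolding t_def by (rule zdiv_mono1[OF le]) simp
    \<comment> \<open>With equal quotients, the smaller remainder would give
      \<open>b (int (Suc j)) < b (int j)\<close>, against monotonicity.\<close>
    moreover have "t j \<noteq> t (Suc j)"
      if "b (int (Suc j)) mod int (m + 1) < b (int j) mod int (m + 1)"
      using that le div_mult_mod_eq[of "b (int j)" "int (m + 1)"]
        div_mult_mod_eq[of "b (int (Suc j))" "int (m + 1)"]
      unfolding t_def by auto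
    ultimately show ?thesis by (auto simp: desc_def)
  qed
  have "t (n + 1) = t 0 + int k"
    unfolding t_def wrap by (simp del: of_nat_Suc of_nat_add)
  then show "(\<Sum>j<n + 1. t (Suc j) - t j) = int k"
    by (subst sum_lessThan_telescope) simp
qed

text \<open>Each descent costs at least one unit of the quotient, and over one period the quotient
  gains exactly \<open>k\<close>.\<close>

lemma cdesc_le_of_lift:
  assumes "equivariant (n + 1) (m + 1) k b"
    and "\<And>j. j \<in> {0..n} \<Longrightarrow> b (int j) mod int (m + 1) = int (\<sigma> j)"
  shows "cdesc n \<sigma> \<le> k"
proof -
  have "int (cdesc n \<sigma>) \<le> (\<Sum>j<n + 1. b (int (Suc j)) div int (m + 1) - b (int j) div int (m + 1))"
    unfolding cdesc_eq_sum_desc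
    by (rule sum_mono) (use lift_increments(1)[OF assms] in auto)
  also have "\<dots> = int k" by (rule lift_increments(2)[OF assms])
  finally show ?thesis by simp
qed

text \<open>In the case of equality the differences between increments and descents are nonnegative
  with sum zero, so each vanishes. The lift is then determined by the quotient of
  \<open>b 0\<close>, which enters as a translation by a multiple of \<open>m + 1\<close>.\<close>

lemma lift_eq_canonical_lift:
  fixes b :: "int \<Rightarrow> int" and n m :: nat
  assumes b: "equivariant (n + 1) (m + 1) k b"
    and res: "\<And>j. j \<in> {0..n} \<Longrightarrow> b (int j) mod int (m + 1) = int (\<sigma> j)"
    and k: "cdesc n \<sigma> = k"
  shows "b i = canonical_lift n m k \<sigma> i + int (m + 1) * (b 0 div int (m + 1))"
proof -
  define t where "t j = b (int j) div int (m + 1)" for j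
  note inc = lift_increments[OF b res, folded t_def]
  have "(\<Sum>j<n + 1. t (Suc j) - t j - desc n \<sigma> j) = 0"
    using inc(2) k cdesc_eq_sum_desc[of n \<sigma>] by (simp only: sum_subtractf)
  then have *: "\<forall>j\<in>{..<n + 1}. t (Suc j) - t j - desc n \<sigma> j = 0"
    using inc(1) by (subst (asm) sum_nonneg_eq_0_iff) auto
  then have step: "t (Suc j) = t j + desc n \<sigma> j" if "j \<le> n" for j
  proof -
    have "j \<in> {..<n + 1}" using that by simp
    with * have "t (Suc j) - t j - desc n \<sigma> j = 0" by (rule bspec)
    then show ?thesis by simp
  qed
  have t: "t j = t 0 + (\<Sum>i<j. desc n \<sigma> i)" if "j \<le> n" for j
    using that by (induction j) (simp_all add: step)
  obtain q r where i: "i = int (n + 1) * q + int r" and r: "r \<le> n" by (rule int_decomp)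
  have "b i = int (m + 1) * (int k * q) + b (int r)"
    using b unfolding i equivariant_def by blast
  \<comment> \<open>Quotient and remainder recover \<open>b\<close> on one period; equivariance has
    already moved the argument there.\<close>
  also have "b (int r) = int (m + 1) * t r + int (\<sigma> r)"
    using res[of r] r unfolding t_def by (metis atLeastAtMost_iff mult_div_mod_eq zero_le)
  finally show ?thesis
    unfolding i canonical_lift_decomp[OF r] t[OF r] unfolding t_def by (simp add: algebra_simps)
qed

section \<open>From lifts back to morphisms\<close>

lemma represents_imp_lift:
  assumes "f \<in> Hom_PF (n + 1) (m + 1)" "represents n m f \<sigma>" "\<sigma> \<in> {0..n} \<rightarrow> {0..m}"
  obtains b where "equivariant (n + 1) (m + 1) (Mod f) b"
    "\<And>j. j \<in> {0..n} \<Longrightarrow> b (int j) mod int (m + 1) = int (\<sigma> j)"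
    "f = mor_of (n + 1) (m + 1) (Mod f) b"
proof -
  obtain b where b: "equivariant (n + 1) (m + 1) (Mod f) b" "f = mor_of (n + 1) (m + 1) (Mod f) b"
    using assms(1) by (rule Hom_PF_imp_mor_of)
  moreover have "\<forall>j\<in>{0..n}. b (int j) mod int (m + 1) = int (\<sigma> j)"
    using assms(2) by (subst (asm) b(2)) (simp only: represents_mor_of_iff[OF b(1) assms(3)])
  ultimately show thesis using that by blast
qed

lemma represents_canonical:
  assumes "\<sigma> \<in> {0..n} \<rightarrow> {0..m}" "cdesc n \<sigma> \<le> k"
  shows "represents n m (mor_of (n + 1) (m + 1) k (canonical_lift n m k \<sigma>)) \<sigma>"
  unfolding represents_mor_of_iff[OF equivariant_canonical_lift[OF assms] assms(1)]
  by (intro ballI canonical_lift_mod[OF assms(1)])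

lemma represents_unique:
  assumes f: "f \<in> Hom_PF (n + 1) (m + 1)" "represents n m f \<sigma>" "\<sigma> \<in> {0..n} \<rightarrow> {0..m}"
    and k: "Mod f = cdesc n \<sigma>"
  shows "f = mor_of (n + 1) (m + 1) (cdesc n \<sigma>) (canonical_lift n m (cdesc n \<sigma>) \<sigma>)"
proof -
  obtain b where b: "equivariant (n + 1) (m + 1) (cdesc n \<sigma>) b"
      "\<And>j. j \<in> {0..n} \<Longrightarrow> b (int j) mod int (m + 1) = int (\<sigma> j)"
      "f = mor_of (n + 1) (m + 1) (cdesc n \<sigma>) b"
    using represents_imp_lift[OF f] unfolding k by blast
  show ?thesis
    by (subst b(3)) (rule mor_of_translate[OF equivariant_canonical_lift[OF f(3) order_refl] b(1)
          lift_eq_canonical_lift[OF b(1,2) refl]])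
qed

lemma PP_map_full:
  assumes \<sigma>: "\<sigma> \<in> PP (n + 1) \<rightarrow>\<^sub>E PP (m + 1)"
  shows "\<exists>f \<in> Hom_PF (n + 1) (m + 1). 1 \<le> Mod f \<and> PP_map (n + 1) (m + 1) f = \<sigma>"
proof -
  \<comment> \<open>The bijections \<open>pt n\<close> and \<open>pt m\<close> transport \<sigma> to
    a map between the fundamental domains.\<close>
  define \<tau> where "\<tau> j = inv_into {0..m} (pt m) (\<sigma> (pt n j))" for j
  note bij = bij_betw_pt[of n] bij_betw_pt[of m]
  have "\<sigma> (pt n j) \<in> pt m ` {0..m}" if "j \<in> {0..n}" for j
    using \<sigma> that bij by (auto simp: bij_betw_def)
  then have \<tau>: "\<tau> \<in> {0..n} \<rightarrow> {0..m}"
    and pt_\<tau>: "\<And>j. j \<in> {0..n} \<Longrightarrow> pt m (\<tau> j) = \<sigma> (pt n j)"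
    unfolding \<tau>_def by (simp_all add: inv_into_into f_inv_into_f del: atLeastAtMost_iff)
  \<comment> \<open>The summand 1 keeps the modulus positive even when \<tau> is constant and has
    descent number 0.\<close>
  define k where "k = cdesc n \<tau> + 1"
  define f where "f = mor_of (n + 1) (m + 1) k (canonical_lift n m k \<tau>)"
  have k: "cdesc n \<tau> \<le> k" by (simp add: k_def)
  have f: "f \<in> Hom_PF (n + 1) (m + 1)"
    unfolding f_def by (rule mor_of_in_Hom_PF[OF equivariant_canonical_lift[OF \<tau> k]])
  have rep: "represents n m f \<tau>"
    unfolding f_def by (rule represents_canonical[OF \<tau> k])
  have "PP_map (n + 1) (m + 1) f X = \<sigma> X" if X: "X \<in> PP (n + 1)" for X
  proof -
    from X obtain j where "j \<in> {0..n}" "X = pt n j"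
      unfolding bij_betw_imp_surj_on[OF bij(1), symmetric] by (rule imageE)
    then show ?thesis using rep pt_\<tau> by (simp add: represents_def)
  qed
  with PP_map_in[OF f] \<sigma> have "PP_map (n + 1) (m + 1) f = \<sigma>" by (rule PiE_ext)
  moreover have "1 \<le> Mod f" by (simp add: f_def k_def)
  ultimately show ?thesis using f by blast
qed

theorem proposition4p8:
  shows
    "(\<forall>n\<ge>1. \<forall>m\<ge>1. \<forall>\<sigma> \<in> PP n \<rightarrow>\<^sub>E PP m.
        \<exists>f \<in> Hom_PF n m. 1 \<le> Mod f \<and> PP_map n m f = \<sigma>) \<and>
     (\<forall>n m. \<forall>\<sigma> \<in> {0..n} \<rightarrow> {0..m}.
        (\<exists>f \<in> Hom_PF (n + 1) (m + 1). Mod f = cdesc n \<sigma> \<and> represents n m f \<sigma>) \<and>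
        (\<forall>k. (\<exists>f \<in> Hom_PF (n + 1) (m + 1). Mod f = k \<and> represents n m f \<sigma>)
              \<longrightarrow> cdesc n \<sigma> \<le> k)) \<and>
     (\<forall>n m k. \<forall>\<sigma> \<in> {0..n} \<rightarrow> {0..m}. cdesc n \<sigma> = k \<longrightarrow>
        (\<exists>!f. f \<in> Hom_PF (n + 1) (m + 1) \<and> Mod f = k \<and> represents n m f \<sigma>))"
proof (intro conjI allI impI ballI)
  fix n m :: nat and \<sigma> assume "1 \<le> n" "1 \<le> m" "\<sigma> \<in> PP n \<rightarrow>\<^sub>E PP m"
  then show "\<exists>f \<in> Hom_PF n m. 1 \<le> Mod f \<and> PP_map n m f = \<sigma>"
    using PP_map_full[of \<sigma> "n - 1" "m - 1"] by simp
next
  fix n m and \<sigma> :: "nat \<Rightarrow> nat" assume \<sigma>: "\<sigma> \<in> {0..n} \<rightarrow> {0..m}"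
  \<comment> \<open>The canonical lift of minimal modulus gives both the morphism attaining the
    minimum and the unique one of that modulus.\<close>
  define f where "f = mor_of (n + 1) (m + 1) (cdesc n \<sigma>) (canonical_lift n m (cdesc n \<sigma>) \<sigma>)"
  have f: "f \<in> Hom_PF (n + 1) (m + 1)" "Mod f = cdesc n \<sigma>" "represents n m f \<sigma>"
    unfolding f_def
    by (rule mor_of_in_Hom_PF[OF equivariant_canonical_lift[OF \<sigma> order_refl]] Mod_mor_of
        represents_canonical[OF \<sigma> order_refl])+
  then show "\<exists>f \<in> Hom_PF (n + 1) (m + 1). Mod f = cdesc n \<sigma> \<and> represents n m f \<sigma>" by blast
  show "\<exists>!f. f \<in> Hom_PF (n + 1) (m + 1) \<and> Mod f = k \<and> represents n m f \<sigma>"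
    if "cdesc n \<sigma> = k" for k
  proof (rule ex1I)
    show "f \<in> Hom_PF (n + 1) (m + 1) \<and> Mod f = k \<and> represents n m f \<sigma>"
      using f that by simp
    show "g = f" if "g \<in> Hom_PF (n + 1) (m + 1) \<and> Mod g = k \<and> represents n m g \<sigma>" for g
      unfolding f_def using that \<open>cdesc n \<sigma> = k\<close> by (intro represents_unique[OF _ _ \<sigma>]) auto
  qed
next
  fix n m k and \<sigma> :: "nat \<Rightarrow> nat" assume \<sigma>: "\<sigma> \<in> {0..n} \<rightarrow> {0..m}"
    and "\<exists>f \<in> Hom_PF (n + 1) (m + 1). Mod f = k \<and> represents n m f \<sigma>"
  then obtain f where f: "f \<in> Hom_PF (n + 1) (m + 1)" "represents n m f \<sigma>" and k: "Mod f = k"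
    by blast
  show "cdesc n \<sigma> \<le> k"
    by (rule represents_imp_lift[OF f \<sigma>], unfold k) (rule cdesc_le_of_lift)
qed

end
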